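(* A consequence relation $\mathrel{|\!\sim}$ (a binary relation on the set $\mathcal{L}(M)$ of compound attributes over a set $M$ of attributes) is rational if and only if it is the consequence relation induced by a ranked context, i.e. $\mathrel{|\!\sim}$ equals $\mathrel{|\!\sim}_{\mathbb{R}}$ for some ranked context $\mathbb{R}=(G,M,I,\prec)$.
   Context: The language $\mathcal{L}(M)$ of compound attributes is generated from the attributes $m\in M$ by $\neg,\land,\lor$ (so compound attributes correspond to propositional formulae with atoms in $M$). A consequence relation $\mathrel{|\!\sim}$ is rational if for all $\phi,\psi,\gamma$: (REF) $\phi\mathrel{|\!\sim}\phi$; (LLE) if $\phi\equiv\psi$ and $\psi\mathrel{|\!\sim}\gamma$, then $\phi\mathrel{|\!\sim}\gamma$; (RW) if $\psi\rightarrow\gamma$ and $\phi\mathrel{|\!\sim}\psi$, then $\phi\mathrel{|\!\sim}\gamma$; (AND) if $\phi\mathrel{|\!\sim}\psi$ and $\phi\mathrel{|\!\sim}\gamma$, then $\phi\mathrel{|\!\sim}\psi\land\gamma$; (OR) if $\phi\mathrel{|\!\sim}\gamma$ and $\psi\mathrel{|\!\sim}\gamma$, then $\phi\lor\psi\mathrel{|\!\sim}\gamma$; (CUT) if $\phi\land\psi\mathrel{|\!\sim}\gamma$ and $\phi\mathrel{|\!\sim}\psi$, then $\phi\mathrel{|\!\sim}\gamma$; (CM) if $\phi\mathrel{|\!\sim}\psi$ and $\phi\mathrel{|\!\sim}\gamma$, then $\phi\land\psi\mathrel{|\!\sim}\gamma$; (RM) if $\phi\mathrel{|\!\sim}\psi$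 and not $\phi\mathrel{|\!\sim}\neg\gamma$, then $\phi\land\gamma\mathrel{|\!\sim}\psi$. Here $\equiv$ is logical equivalence and $\rightarrow$ is implication of the underlying logic; relative to a given context (as defined next), $\phi\equiv\psi$ is read as $\phi^\downarrow=\psi^\downarrow$ and $\phi\rightarrow\psi$ as $\phi^\downarrow\subseteq\psi^\downarrow$. A ranked context is $\mathbb{R}=(G,M,I,\prec)$ with $G$ a set of objects, $M$ a set of attributes, $I\subseteq G\times M$, and $\prec$ a modular strict partial order on $G$; modular means: for all $g_0,g_1,g_2\in G$, if $g_0\not\prec g_1$, $g_1\not\prec g_0$ and $g_2\prec g_0$, then $g_2\prec g_1$ (equivalently, there is a ranking function from $G$ into a totally ordered set such that $g_0\prec g_1$ iff the rank of $g_0$ is strictly below that of $g_1$). Extents $\phi^\downarrow\subseteq G$ of $\phi\in\mathcal{L}(M)$: $m^\downarrow=\{g\in G\mid (g,m)\in I\}$, $(\neg\phi)^\downarrow=G\setminus\phi^\downarrow$, $(\phi\land\psi)^\downarrow=\phi^\downarrow\cap\psi^\downarrow$, $(\phi\lor\psi)^\downarrow=\phi^\downarrow\cup\psi^\downarrow$. For $B\subseteq G$ let $\underline{B}=\{g\in B\mid \nexists h\in B,\ h\prec g\}$. The induced relation is: $\phi\mathrel{|\!\sim}_{\mathbb{R}}\psi$ iff $\underline{\phi^\downarrow}\subseteq\psi^\downarrow$.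
   Formalization: The ranked contexts are also required to be smooth: each object in the extent of a compound attribute is minimal there or has a minimal object of that extent preferred to it. Without this the "if" direction fails (CM) for some infinite G; finite and well-founded contexts are always smooth. *)

theory Defs
  imports Main
begin

datatype (attrs: 'm) form =
    Attr 'm
  | Neg "'m form"
  | And "'m form" "'m form"
  | Or "'m form" "'m form"

definition lang :: "'m set \<Rightarrow> 'm form set" where
  "lang M = {\<phi>. attrs \<phi> \<subseteq> M}"

primrec sat :: "'m set \<Rightarrow> 'm form \<Rightarrow> bool" where
  "sat v (Attr m) \<longleftrightarrow> m \<in> v"
| "sat v (Neg \<phi>) \<longleftrightarrow> \<not> sat v \<phi>"
| "sat v (And \<phi> \<psi>) \<longleftrightarrow> sat v \<phi> \<and> sat v \<psi>"
| "sat v (Or \<phi> \<psi>) \<longleftrightarrow> sat v \<phi> \<or> sat v \<psi>"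

definition entails :: "'m form \<Rightarrow> 'm form \<Rightarrow> bool" where
  "entails \<phi> \<psi> \<longleftrightarrow> (\<forall>v. sat v \<phi> \<longrightarrow> sat v \<psi>)"

(* The parameter imp is the implication of the underlying logic; logical equivalence is
   implication in both directions.  It is used both with entails and with the inclusion of
   extents in a fixed context (ctx_implies below).  The conjuncts are, in order,
   REF, LLE, RW, AND, OR, CUT, CM, RM. *)
definition rational ::
    "'m set \<Rightarrow> ('m form \<Rightarrow> 'm form \<Rightarrow> bool) \<Rightarrow> ('m form \<times> 'm form) set \<Rightarrow> bool" where
  "rational M imp C \<longleftrightarrow>
    (\<forall>\<phi>\<in>lang M. (\<phi>, \<phi>) \<in> C) \<and>
    (\<forall>\<phi>\<in>lang M. \<forall>\<psi>\<in>lang M. \<forall>\<gamma>\<in>lang M.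
       (imp \<phi> \<psi> \<and> imp \<psi> \<phi> \<and> (\<psi>, \<gamma>) \<in> C \<longrightarrow> (\<phi>, \<gamma>) \<in> C) \<and>
       (imp \<psi> \<gamma> \<and> (\<phi>, \<psi>) \<in> C \<longrightarrow> (\<phi>, \<gamma>) \<in> C) \<and>
       ((\<phi>, \<psi>) \<in> C \<and> (\<phi>, \<gamma>) \<in> C \<longrightarrow> (\<phi>, And \<psi> \<gamma>) \<in> C) \<and>
       ((\<phi>, \<gamma>) \<in> C \<and> (\<psi>, \<gamma>) \<in> C \<longrightarrow> (Or \<phi> \<psi>, \<gamma>) \<in> C) \<and>
       ((And \<phi> \<psi>, \<gamma>) \<in> C \<and> (\<phi>, \<psi>) \<in> C \<longrightarrow> (\<phi>, \<gamma>) \<in> C) \<and>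
       ((\<phi>, \<psi>) \<in> C \<and> (\<phi>, \<gamma>) \<in> C \<longrightarrow> (And \<phi> \<psi>, \<gamma>) \<in> C) \<and>
       ((\<phi>, \<psi>) \<in> C \<and> (\<phi>, Neg \<gamma>) \<notin> C \<longrightarrow> (And \<phi> \<gamma>, \<psi>) \<in> C))"

(* (g, h) \<in> P stands for g \<prec> h, i.e. g is preferred to h. *)
definition ranked_context ::
    "'g set \<Rightarrow> 'm set \<Rightarrow> ('g \<times> 'm) set \<Rightarrow> ('g \<times> 'g) set \<Rightarrow> bool" where
  "ranked_context G M I P \<longleftrightarrow>
    I \<subseteq> G \<times> M \<and> P \<subseteq> G \<times> G \<and> irrefl P \<and> trans P \<and>
    (\<forall>g0\<in>G. \<forall>g1\<in>G. \<forall>g2\<in>G.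
       (g0, g1) \<notin> P \<and> (g1, g0) \<notin> P \<and> (g2, g0) \<in> P \<longrightarrow> (g2, g1) \<in> P)"

primrec extent :: "'g set \<Rightarrow> ('g \<times> 'm) set \<Rightarrow> 'm form \<Rightarrow> 'g set" where
  "extent G I (Attr m) = {g \<in> G. (g, m) \<in> I}"
| "extent G I (Neg \<phi>) = G - extent G I \<phi>"
| "extent G I (And \<phi> \<psi>) = extent G I \<phi> \<inter> extent G I \<psi>"
| "extent G I (Or \<phi> \<psi>) = extent G I \<phi> \<union> extent G I \<psi>"

definition ctx_implies :: "'g set \<Rightarrow> ('g \<times> 'm) set \<Rightarrow> 'm form \<Rightarrow> 'm form \<Rightarrow> bool" where
  "ctx_implies G I \<phi> \<psi> \<longleftrightarrow> extent G I \<phi> \<subseteq> extent G I \<psi>"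

definition minimals :: "('g \<times> 'g) set \<Rightarrow> 'g set \<Rightarrow> 'g set" where
  "minimals P B = {g \<in> B. \<not> (\<exists>h\<in>B. (h, g) \<in> P)}"

(* The smoothness condition of Kraus, Lehmann and Magidor.  It holds automatically when G is
   finite or P is well-founded.  For arbitrary infinite G it cannot be dropped: let P order
   G = {..., -2, -1, 0} as usual and let 0 be the only object with attribute a.  The extent of
   t = Or a (Neg a) has no minimal element, so t induces both a and Neg a, but And t a does
   not induce Neg a, and CM fails. *)
definition smooth ::
    "'g set \<Rightarrow> 'm set \<Rightarrow> ('g \<times> 'm) set \<Rightarrow> ('g \<times> 'g) set \<Rightarrow> bool" where
  "smooth G M I P \<longleftrightarrow>
    (\<forall>\<phi>\<in>lang M. \<forall>g\<in>extent G I \<phi>.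
       g \<in> minimals P (extent G I \<phi>) \<or>
       (\<exists>h\<in>minimals P (extent G I \<phi>). (h, g) \<in> P))"

definition induced ::
    "'g set \<Rightarrow> 'm set \<Rightarrow> ('g \<times> 'm) set \<Rightarrow> ('g \<times> 'g) set \<Rightarrow> ('m form \<times> 'm form) set" where
  "induced G M I P =
    {(\<phi>, \<psi>). \<phi> \<in> lang M \<and> \<psi> \<in> lang M \<and> minimals P (extent G I \<phi>) \<subseteq> extent G I \<psi>}"

(* HOL cannot quantify existentially over the type of objects of a context.  Pairs of a
   valuation and a formula suffice as objects to represent every rational relation over M,
   with M of any cardinality. *)
type_synonym 'm obj = "'m set \<times> 'm form"

end

theory Submission
  imports Defs
begin

text \<open>
  Soundness: smoothness gives CM, and modularity gives RM, because a minimal object of \<open>A\<close> that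
  lies in \<open>B\<close> is incomparable to every minimal object of \<open>A \<inter> B\<close>.

  Completeness follows Lehmann and Magidor. Call \<open>\<alpha>\<close> preferred to \<open>\<beta>\<close> if \<open>\<alpha> \<or> \<beta>\<close> induces \<open>\<not>\<beta>\<close>.
  On formulae that do not induce a contradiction, RM makes this asymmetric and negatively
  transitive. The objects are the pairs \<open>(v, \<alpha>)\<close> such that \<open>v\<close> satisfies all consequences of \<open>\<alpha>\<close>,
  ordered by the second component. A minimal object \<open>(v, \<alpha>)\<close> of the extent of \<open>\<phi>\<close> has \<open>\<alpha>\<close> of the same
  rank as \<open>\<phi>\<close>, so if \<open>\<phi>\<close> induces \<open>\<psi>\<close> then \<open>\<alpha>\<close> induces \<open>\<phi> \<rightarrow> \<psi>\<close>. Conversely, if \<open>\<phi>\<close> does not induce \<open>\<psi>\<close>,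
  then a prime theory separating the consequences of \<open>\<phi>\<close> from \<open>\<psi>\<close> yields an object \<open>(v, \<phi>)\<close> that
  refutes \<open>\<psi>\<close>.
\<close>

lemma lang_simps [simp]:
  "Attr m \<in> lang M \<longleftrightarrow> m \<in> M"
  "Neg \<phi> \<in> lang M \<longleftrightarrow> \<phi> \<in> lang M"
  "And \<phi> \<psi> \<in> lang M \<longleftrightarrow> \<phi> \<in> lang M \<and> \<psi> \<in> lang M"
  "Or \<phi> \<psi> \<in> lang M \<longleftrightarrow> \<phi> \<in> lang M \<and> \<psi> \<in> lang M"
  by (auto simp: lang_def)

subsection \<open>Prime theories\<close>

text \<open>Neither consistency nor nonemptiness is built in: omission of a given formula takes the
  place of the former, and the empty set qualifies.\<close>

definition theory_on :: "'m set \<Rightarrow> 'm form set \<Rightarrow> bool" where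
  "theory_on M T \<longleftrightarrow> T \<subseteq> lang M \<and> (\<forall>\<phi>\<in>T. \<forall>\<psi>\<in>T. And \<phi> \<psi> \<in> T) \<and>
     (\<forall>\<phi>\<in>T. \<forall>\<psi>\<in>lang M. entails \<phi> \<psi> \<longrightarrow> \<psi> \<in> T)"

lemma theory_onD:
  assumes "theory_on M T"
  shows "\<phi> \<in> T \<Longrightarrow> \<phi> \<in> lang M"
    and "\<phi> \<in> T \<Longrightarrow> \<psi> \<in> T \<Longrightarrow> And \<phi> \<psi> \<in> T"
    and "\<phi> \<in> T \<Longrightarrow> entails \<phi> \<psi> \<Longrightarrow> \<psi> \<in> lang M \<Longrightarrow> \<psi> \<in> T"
  using assms by (auto simp: theory_on_def)

lemma theory_on_Union_chain:
  assumes "subset.chain A K" and "\<And>T. T \<in> K \<Longrightarrow> theory_on M T"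
  shows "theory_on M (\<Union>K)"
proof -
  have "And \<phi> \<psi> \<in> \<Union>K" if "\<phi> \<in> T" "T \<in> K" "\<psi> \<in> U" "U \<in> K" for \<phi> \<psi> T U
  proof -
    have "T \<subseteq> U \<or> U \<subseteq> T"
      using assms(1) that by (auto simp: subset.chain_def)
    then show ?thesis
      using that assms(2) theory_onD(2) by (metis Union_iff subsetD)
  qed
  then show ?thesis
    using theory_onD(1,3)[OF assms(2)] unfolding theory_on_def by blast
qed

text \<open>Lindenbaum's construction, by Zorn's lemma so that M may have any cardinality. A theory
  maximal among those that extend \<open>\<Gamma>\<close> and omit \<psi> decides every formula of
  \<open>lang M\<close>, so within \<open>lang M\<close> it is the truth set of the valuation read
  off from its attributes.\<close>

lemma theory_separation:
  assumes \<Gamma>: "theory_on M \<Gamma>" and "\<Gamma> \<noteq> {}" and "\<psi> \<in> lang M" and "\<psi> \<notin> \<Gamma>"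
  shows "\<exists>v. (\<forall>\<phi>\<in>\<Gamma>. sat v \<phi>) \<and> \<not> sat v \<psi>"
proof -
  define A where "A = {T. theory_on M T \<and> \<Gamma> \<subseteq> T \<and> \<psi> \<notin> T}"
  have "\<exists>T\<in>A. \<forall>X\<in>A. T \<subseteq> X \<longrightarrow> X = T"
  proof (rule subset_Zorn_nonempty)
    show "A \<noteq> {}"
      using assms by (auto simp: A_def)
  next
    fix K assume K: "K \<noteq> {}" "subset.chain A K"
    then have "K \<subseteq> A"
      by (auto simp: subset.chain_def)
    then show "\<Union>K \<in> A"
      using theory_on_Union_chain[OF K(2)] K(1) unfolding A_def by blast
  qed
  then obtain T where "T \<in> A" and maximal: "\<And>X. X \<in> A \<Longrightarrow> T \<subseteq> X \<Longrightarrow> X = T"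
    by blast
  then have T: "theory_on M T" "\<Gamma> \<subseteq> T" "\<psi> \<notin> T"
    by (auto simp: A_def)
  note TD = theory_onD[OF T(1)]
  \<comment> \<open>Otherwise the theory generated by T and \<phi> would still omit \<psi>, against
    maximality.\<close>
  have extend: "\<exists>\<tau>\<in>T. entails (And \<tau> \<phi>) \<psi>" if \<phi>: "\<phi> \<in> lang M" "\<phi> \<notin> T" for \<phi>
  proof (rule ccontr)
    assume no: "\<not> ?thesis"
    define X where "X = {\<chi>\<in>lang M. \<exists>\<tau>\<in>T. entails (And \<tau> \<phi>) \<chi>}"
    have "And \<chi> \<chi>' \<in> X" if \<chi>: "\<chi> \<in> X" "\<chi>' \<in> X" for \<chi> \<chi>'
    proof -
      obtain \<tau> \<tau>' where "\<tau> \<in> T" "entails (And \<tau> \<phi>) \<chi>" "\<tau>' \<in> T" "entails (And \<tau>' \<phi>) \<chi>'"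
        using \<chi> by (auto simp: X_def)
      then have "And \<tau> \<tau>' \<in> T" "entails (And (And \<tau> \<tau>') \<phi>) (And \<chi> \<chi>')"
        using TD(2) by (auto simp: entails_def)
      then show ?thesis
        using \<chi> by (auto simp: X_def)
    qed
    moreover have "\<chi>' \<in> X" if "\<chi> \<in> X" "entails \<chi> \<chi>'" "\<chi>' \<in> lang M" for \<chi> \<chi>'
      using that unfolding X_def entails_def by blast
    ultimately have "theory_on M X"
      by (auto simp: theory_on_def X_def)
    moreover have "T \<subseteq> X"
      using TD(1) by (force simp: X_def entails_def)
    moreover have "\<psi> \<notin> X"
      using no by (auto simp: X_def)
    ultimately have "X = T"
      using T(2) by (intro maximal) (auto simp: A_def)
    moreover have "\<phi> \<in> X"
      using \<phi>(1) \<open>\<Gamma> \<noteq> {}\<close> T(2) by (auto simp: X_def entails_def)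
    ultimately show False
      using \<phi>(2) by simp
  qed
  have neg: "Neg \<phi> \<in> T \<longleftrightarrow> \<phi> \<notin> T" if \<phi>: "\<phi> \<in> lang M" for \<phi>
  proof
    assume "Neg \<phi> \<in> T"
    moreover have "entails (And \<phi> (Neg \<phi>)) \<psi>"
      by (simp add: entails_def)
    ultimately show "\<phi> \<notin> T"
      using TD(2,3) T(3) assms(3) by blast
  next
    assume "\<phi> \<notin> T"
    show "Neg \<phi> \<in> T"
    proof (rule ccontr)
      assume "Neg \<phi> \<notin> T"
      \<comment> \<open>The conjunction of the two witnesses entails \<psi> by case distinction on
        \<phi>.\<close>
      then obtain \<tau> \<tau>' where "\<tau> \<in> T" "entails (And \<tau> \<phi>) \<psi>" "\<tau>' \<in> T" "entails (And \<tau>' (Neg \<phi>)) \<psi>"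
        using extend[of \<phi>] extend[of "Neg \<phi>"] \<phi> \<open>\<phi> \<notin> T\<close> by auto
      then have "And \<tau> \<tau>' \<in> T" "entails (And \<tau> \<tau>') \<psi>"
        using TD(2) by (auto simp: entails_def)
      then show False
        using TD(3) T(3) assms(3) by blast
    qed
  qed
  have conj: "And \<phi> \<chi> \<in> T \<longleftrightarrow> \<phi> \<in> T \<and> \<chi> \<in> T" if "\<phi> \<in> lang M" "\<chi> \<in> lang M" for \<phi> \<chi>
  proof -
    have "entails (And \<phi> \<chi>) \<phi>" "entails (And \<phi> \<chi>) \<chi>"
      by (auto simp: entails_def)
    then show ?thesis
      using TD(2,3) that by blast
  qed
  \<comment> \<open>De Morgan reduces primeness to the facts on negation and conjunction.\<close>
  have disj: "Or \<phi> \<chi> \<in> T \<longleftrightarrow> \<phi> \<in> T \<or> \<chi> \<in> T" if "\<phi> \<in> lang M" "\<chi> \<in> lang M" for \<phi> \<chi>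
  proof -
    have "entails (Or \<phi> \<chi>) (Neg (And (Neg \<phi>) (Neg \<chi>)))"
      "entails (Neg (And (Neg \<phi>) (Neg \<chi>))) (Or \<phi> \<chi>)"
      by (auto simp: entails_def)
    then have "Or \<phi> \<chi> \<in> T \<longleftrightarrow> Neg (And (Neg \<phi>) (Neg \<chi>)) \<in> T"
      using TD(3) that by (meson lang_simps)
    then show ?thesis
      using that by (simp add: neg conj)
  qed
  have truth: "sat {m. Attr m \<in> T} \<phi> \<longleftrightarrow> \<phi> \<in> T" if "\<phi> \<in> lang M" for \<phi>
    using that by (induction \<phi>) (simp_all add: neg conj disj)
  then show ?thesis
    using T TD(1) assms(3) by (intro exI[of _ "{m. Attr m \<in> T}"]) blast
qed

subsection \<open>Rational relations\<close>

locale rational_relation =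
  fixes M :: "'m set" and C :: "('m form \<times> 'm form) set"
  assumes rational: "rational M entails C" and subset: "C \<subseteq> lang M \<times> lang M"
begin

section \<open>Derived rules of rational consequence\<close>

lemma langD: "(\<phi>, \<psi>) \<in> C \<Longrightarrow> \<phi> \<in> lang M" "(\<phi>, \<psi>) \<in> C \<Longrightarrow> \<psi> \<in> lang M"
  using subset by auto

lemma REF: "\<phi> \<in> lang M \<Longrightarrow> (\<phi>, \<phi>) \<in> C"
  using rational by (auto simp: rational_def)

lemmas postulates = rational[unfolded rational_def, THEN conjunct2, rule_format]

lemma LLE:
  "(\<psi>, \<gamma>) \<in> C \<Longrightarrow> \<phi> \<in> lang M \<Longrightarrow> entails \<phi> \<psi> \<Longrightarrow> entails \<psi> \<phi> \<Longrightarrow> (\<phi>, \<gamma>) \<in> C"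
  using postulates[of \<phi> \<psi> \<gamma>] langD by blast

lemma RW: "(\<phi>, \<psi>) \<in> C \<Longrightarrow> \<gamma> \<in> lang M \<Longrightarrow> entails \<psi> \<gamma> \<Longrightarrow> (\<phi>, \<gamma>) \<in> C"
  using postulates[of \<phi> \<psi> \<gamma>] langD by blast

lemma AND: "(\<phi>, \<psi>) \<in> C \<Longrightarrow> (\<phi>, \<gamma>) \<in> C \<Longrightarrow> (\<phi>, And \<psi> \<gamma>) \<in> C"
  using postulates[of \<phi> \<psi> \<gamma>] langD by blast

lemma OR: "(\<phi>, \<gamma>) \<in> C \<Longrightarrow> (\<psi>, \<gamma>) \<in> C \<Longrightarrow> (Or \<phi> \<psi>, \<gamma>) \<in> C"
  using postulates[of \<phi> \<psi> \<gamma>] langD by blast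

lemma CM: "(\<phi>, \<psi>) \<in> C \<Longrightarrow> (\<phi>, \<gamma>) \<in> C \<Longrightarrow> (And \<phi> \<psi>, \<gamma>) \<in> C"
  using postulates[of \<phi> \<psi> \<gamma>] langD by blast

lemma RM:
  "(\<phi>, \<psi>) \<in> C \<Longrightarrow> \<gamma> \<in> lang M \<Longrightarrow> (\<phi>, Neg \<gamma>) \<notin> C \<Longrightarrow> (And \<phi> \<gamma>, \<psi>) \<in> C"
  using postulates[of \<phi> \<psi> \<gamma>] langD by blast

text \<open>Here \<open>And \<phi> \<gamma>\<close> is equivalent to \<gamma>. The later uses of RM
  have this form: they pass from a disjunction to one of its parts.\<close>

lemma RM_entails:
  assumes "(\<phi>, \<psi>) \<in> C" "\<gamma> \<in> lang M" "entails \<gamma> \<phi>" "(\<phi>, Neg \<gamma>) \<notin> C"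
  shows "(\<gamma>, \<psi>) \<in> C"
  using RM[OF assms(1,2,4)] assms(2) by (rule LLE) (use assms(3) in \<open>auto simp: entails_def\<close>)

lemma RW2:
  assumes "(\<phi>, \<psi>) \<in> C" "(\<phi>, \<gamma>) \<in> C" "\<chi> \<in> lang M" "entails (And \<psi> \<gamma>) \<chi>"
  shows "(\<phi>, \<chi>) \<in> C"
  using AND[OF assms(1,2)] assms(3,4) by (rule RW)

text \<open>A conditional may fail under a weaker antecedent, but its material implication survives:
  split \<delta> into \<phi> and \<open>And \<delta> (Neg \<phi>)\<close>. The second case satisfies
  the implication trivially, and OR joins the two.\<close>

lemma cond_weaken_left:
  assumes "(\<phi>, \<psi>) \<in> C" "\<delta> \<in> lang M" "entails \<phi> \<delta>"
  shows "(\<delta>, Or (Neg \<phi>) \<psi>) \<in> C"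
proof -
  have l: "\<phi> \<in> lang M" "\<psi> \<in> lang M"
    using langD assms(1) by auto
  have "(\<phi>, Or (Neg \<phi>) \<psi>) \<in> C"
    using assms(1) by (rule RW) (use l in \<open>auto simp: entails_def\<close>)
  moreover have "(And \<delta> (Neg \<phi>), Or (Neg \<phi>) \<psi>) \<in> C"
    by (rule RW[OF REF]) (use l assms(2) in \<open>auto simp: entails_def\<close>)
  ultimately have "(Or \<phi> (And \<delta> (Neg \<phi>)), Or (Neg \<phi>) \<psi>) \<in> C"
    by (rule OR)
  then show ?thesis
    by (rule LLE) (use assms in \<open>auto simp: entails_def\<close>)
qed

section \<open>Consistent formulae and the preference order\<close>

definition consistent :: "'m form \<Rightarrow> bool" where
  "consistent \<phi> \<longleftrightarrow> \<phi> \<in> lang M \<and> (\<phi>, Neg \<phi>) \<notin> C"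

lemma consistent_lang: "consistent \<phi> \<Longrightarrow> \<phi> \<in> lang M"
  by (simp add: consistent_def)

lemma consistentI:
  assumes "(\<phi>, \<psi>) \<notin> C" "\<phi> \<in> lang M" "\<psi> \<in> lang M"
  shows "consistent \<phi>"
proof -
  have "(\<phi>, \<psi>) \<in> C" if "(\<phi>, Neg \<phi>) \<in> C"
    by (rule RW2[OF REF that]) (use assms in \<open>auto simp: entails_def\<close>)
  then show ?thesis
    using assms by (auto simp: consistent_def)
qed

text \<open>An inconsistent \<delta> induces every formula, in particular \<phi> and
  \<open>Neg \<phi>\<close>, so CM carries \<open>Neg \<phi>\<close> over to
  \<open>And \<delta> \<phi>\<close>, which is equivalent to \<phi>.\<close>

lemma consistent_weaken:
  assumes "consistent \<phi>" "entails \<phi> \<delta>" "\<delta> \<in> lang M"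
  shows "consistent \<delta>"
proof -
  have "(\<phi>, Neg \<phi>) \<in> C" if "(\<delta>, Neg \<delta>) \<in> C"
  proof -
    have "(\<delta>, \<chi>) \<in> C" if "\<chi> \<in> lang M" for \<chi>
      by (rule RW2[OF REF \<open>(\<delta>, Neg \<delta>) \<in> C\<close>]) (use assms that in \<open>auto simp: entails_def\<close>)
    then have "(And \<delta> \<phi>, Neg \<phi>) \<in> C"
      using assms(1) by (intro CM) (auto simp: consistent_def)
    then show ?thesis
      by (rule LLE) (use assms in \<open>auto simp: entails_def consistent_def\<close>)
  qed
  then show ?thesis
    using assms by (auto simp: consistent_def)
qed

text \<open>In a smooth ranked context this says that every object satisfying \<beta> lies strictly
  above some object satisfying \<alpha>. An inconsistent formula is preferred to itself, so
  strictness can be expected only between consistent ones.\<close>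

definition pref :: "'m form \<Rightarrow> 'm form \<Rightarrow> bool" where
  "pref \<alpha> \<beta> \<longleftrightarrow> (Or \<alpha> \<beta>, Neg \<beta>) \<in> C"

text \<open>If the disjunction excluded \<alpha> as well as \<beta>, it would be inconsistent,
  although it is weaker than the consistent \<alpha>. The form with \<open>\<notin>\<close> is the
  premise that RM needs for passing from the disjunction to \<alpha>.\<close>

lemma pref_asym_left:
  assumes "consistent \<alpha>" "pref \<alpha> \<beta>"
  shows "(Or \<alpha> \<beta>, Neg \<alpha>) \<notin> C"
proof
  assume *: "(Or \<alpha> \<beta>, Neg \<alpha>) \<in> C"
  have l: "\<alpha> \<in> lang M" "\<beta> \<in> lang M"
    using langD[OF *] by auto
  have "(Or \<alpha> \<beta>, Neg (Or \<alpha> \<beta>)) \<in> C"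
    by (rule RW2[OF * assms(2)[unfolded pref_def]]) (use l in \<open>auto simp: entails_def\<close>)
  moreover have "consistent (Or \<alpha> \<beta>)"
    by (rule consistent_weaken[OF assms(1)]) (use l in \<open>auto simp: entails_def\<close>)
  ultimately show False
    by (simp add: consistent_def)
qed

lemma pref_asym:
  assumes "consistent \<alpha>" "pref \<alpha> \<beta>"
  shows "\<not> pref \<beta> \<alpha>"
proof
  assume "pref \<beta> \<alpha>"
  then have *: "(Or \<beta> \<alpha>, Neg \<alpha>) \<in> C"
    by (simp add: pref_def)
  have "(Or \<alpha> \<beta>, Neg \<alpha>) \<in> C"
    using * by (rule LLE) (use langD[OF *] in \<open>auto simp: entails_def\<close>)
  then show False
    using pref_asym_left[OF assms] by simp
qed

text \<open>Compare all three formulae inside their disjunction \<delta>. It excludes \<gamma>, and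
  if \<beta> is not preferred to \<gamma>, it excludes \<beta> too. Being consistent, it then cannot
  exclude \<open>Or \<alpha> \<beta>\<close>, so RM restricts \<open>Neg \<beta>\<close> to that
  disjunction.\<close>

lemma pref_negtrans:
  assumes "consistent \<alpha>" "\<beta> \<in> lang M" "pref \<alpha> \<gamma>"
  shows "pref \<alpha> \<beta> \<or> pref \<beta> \<gamma>"
proof (rule disjCI)
  assume not_pref: "\<not> pref \<beta> \<gamma>"
  define \<delta> where "\<delta> = Or \<alpha> (Or \<beta> \<gamma>)"
  have *: "(Or \<alpha> \<gamma>, Neg \<gamma>) \<in> C"
    using assms(3) by (simp add: pref_def)
  have l: "\<alpha> \<in> lang M" "\<beta> \<in> lang M" "\<gamma> \<in> lang M" "\<delta> \<in> lang M"
    using langD[OF *] assms(2) by (auto simp: \<delta>_def)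
  have "(\<delta>, Or (Neg (Or \<alpha> \<gamma>)) (Neg \<gamma>)) \<in> C"
    by (rule cond_weaken_left[OF *]) (use l in \<open>auto simp: \<delta>_def entails_def\<close>)
  then have \<gamma>: "(\<delta>, Neg \<gamma>) \<in> C"
    by (rule RW) (use l in \<open>auto simp: entails_def\<close>)
  \<comment> \<open>RM by contraposition: if \<delta> did not exclude
    \<open>Or \<beta> \<gamma>\<close>, then \<open>Neg \<gamma>\<close> would pass to that
    disjunction and \<beta> would be preferred to \<gamma>.\<close>
  have "(\<delta>, Neg (Or \<beta> \<gamma>)) \<in> C"
  proof (rule ccontr)
    assume "(\<delta>, Neg (Or \<beta> \<gamma>)) \<notin> C"
    then have "(Or \<beta> \<gamma>, Neg \<gamma>) \<in> C"
      by (rule RM_entails[OF \<gamma>, rotated 2]) (use l in \<open>auto simp: \<delta>_def entails_def\<close>)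
    then show False
      using not_pref by (simp add: pref_def)
  qed
  then have \<beta>: "(\<delta>, Neg \<beta>) \<in> C"
    by (rule RW) (use l in \<open>auto simp: entails_def\<close>)
  have "consistent \<delta>"
    by (rule consistent_weaken[OF assms(1)]) (use l in \<open>auto simp: \<delta>_def entails_def\<close>)
  moreover have "(\<delta>, Neg \<delta>) \<in> C" if "(\<delta>, Neg (Or \<alpha> \<beta>)) \<in> C"
    by (rule RW2[OF that \<gamma>]) (use l in \<open>auto simp: \<delta>_def entails_def\<close>)
  ultimately have "(\<delta>, Neg (Or \<alpha> \<beta>)) \<notin> C"
    by (auto simp: consistent_def)
  then have "(Or \<alpha> \<beta>, Neg \<beta>) \<in> C"
    by (rule RM_entails[OF \<beta>, rotated 2]) (use l in \<open>auto simp: \<delta>_def entails_def\<close>)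
  then show "pref \<alpha> \<beta>"
    by (simp add: pref_def)
qed

text \<open>Preference of \<alpha> would let RM pass from \<open>Or \<alpha> \<phi>\<close> to
  \<alpha> and yield \<open>Neg \<phi>\<close>. Hence an object satisfying \<phi> never carries a
  formula ranked strictly below \<phi>.\<close>

lemma not_pref_if_compatible:
  assumes "consistent \<alpha>" "\<phi> \<in> lang M" "(\<alpha>, Neg \<phi>) \<notin> C"
  shows "\<not> pref \<alpha> \<phi>"
proof
  assume pref: "pref \<alpha> \<phi>"
  have "(\<alpha>, Neg \<phi>) \<in> C"
    by (rule RM_entails[OF pref[unfolded pref_def] _ _ pref_asym_left[OF assms(1) pref]])
      (use assms in \<open>auto simp: consistent_def entails_def\<close>)
  then show False
    using assms(3) by simp
qed

text \<open>An inconsistent \<phi> is excluded by every weaker formula, so \<alpha> would be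
  preferred to it.\<close>

lemma consistent_if_compatible:
  assumes "consistent \<alpha>" "\<phi> \<in> lang M" "(\<alpha>, Neg \<phi>) \<notin> C"
  shows "consistent \<phi>"
proof (rule ccontr)
  assume "\<not> consistent \<phi>"
  then have "(\<phi>, Neg \<phi>) \<in> C"
    using assms by (simp add: consistent_def)
  then have "(Or \<alpha> \<phi>, Or (Neg \<phi>) (Neg \<phi>)) \<in> C"
    by (rule cond_weaken_left) (use assms in \<open>auto simp: consistent_def entails_def\<close>)
  then have "pref \<alpha> \<phi>"
    unfolding pref_def by (rule RW) (use assms in \<open>auto simp: entails_def\<close>)
  then show False
    using not_pref_if_compatible[OF assms] by simp
qed

text \<open>In \<open>Or \<phi> \<alpha>\<close> the conditional becomes a material implication.
  That \<phi> is not preferred to \<alpha> says exactly that this disjunction does not exclude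
  \<alpha>, so RM restricts the implication to \<alpha>.\<close>

lemma cond_transfer:
  assumes "consistent \<alpha>" "(\<phi>, \<psi>) \<in> C" "\<not> pref \<phi> \<alpha>"
  shows "(\<alpha>, Or (Neg \<phi>) \<psi>) \<in> C"
proof (rule RM_entails[of "Or \<phi> \<alpha>"])
  show "(Or \<phi> \<alpha>, Or (Neg \<phi>) \<psi>) \<in> C"
    by (rule cond_weaken_left[OF assms(2)])
      (use langD[OF assms(2)] assms(1) in \<open>auto simp: consistent_def entails_def\<close>)
qed (use assms in \<open>auto simp: consistent_def pref_def entails_def\<close>)

section \<open>The canonical ranked context\<close>

definition normal :: "'m set \<Rightarrow> 'm form \<Rightarrow> bool" where
  "normal v \<alpha> \<longleftrightarrow> (\<forall>\<beta>. (\<alpha>, \<beta>) \<in> C \<longrightarrow> sat v \<beta>)"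

text \<open>REF, AND and RW make the consequences of \<phi> a nonempty theory, to which separation
  applies. With \<open>Neg \<phi>\<close> for \<psi> this provides an object for every consistent
  \<phi>.\<close>

lemma normal_refuting:
  assumes "\<phi> \<in> lang M" "\<psi> \<in> lang M" "(\<phi>, \<psi>) \<notin> C"
  shows "\<exists>v. normal v \<phi> \<and> \<not> sat v \<psi>"
proof -
  have "theory_on M {\<beta>. (\<phi>, \<beta>) \<in> C}"
    using langD(2)[of \<phi>] AND[of \<phi>] RW[of \<phi>] unfolding theory_on_def by blast
  then have "\<exists>v. (\<forall>\<beta>\<in>{\<beta>. (\<phi>, \<beta>) \<in> C}. sat v \<beta>) \<and> \<not> sat v \<psi>"
    by (rule theory_separation) (use assms REF in auto)
  then show ?thesis
    by (auto simp: normal_def)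
qed

definition objs :: "'m obj set" where
  "objs = {(v, \<alpha>). consistent \<alpha> \<and> normal v \<alpha>}"

definition inc :: "('m obj \<times> 'm) set" where
  "inc = {((v, \<alpha>), m). (v, \<alpha>) \<in> objs \<and> m \<in> M \<and> m \<in> v}"

definition prec :: "('m obj \<times> 'm obj) set" where
  "prec = {(x, y). x \<in> objs \<and> y \<in> objs \<and> pref (snd x) (snd y)}"

text \<open>The restriction to \<open>lang M\<close> matters: v may contain attributes outside M,
  which \<open>inc\<close> discards.\<close>

lemma extent_objs: "\<phi> \<in> lang M \<Longrightarrow> extent objs inc \<phi> = {(v, \<alpha>) \<in> objs. sat v \<phi>}"
  by (induction \<phi>) (auto simp: inc_def)

lemma in_extent_iff:
  "\<phi> \<in> lang M \<Longrightarrow> (v, \<alpha>) \<in> extent objs inc \<phi> \<longleftrightarrow> consistent \<alpha> \<and> normal v \<alpha> \<and> sat v \<phi>"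
  by (simp add: extent_objs) (simp add: objs_def)

lemma ranked_context_objs: "ranked_context objs M inc prec"
proof -
  have asym: "(y, x) \<notin> prec" if "(x, y) \<in> prec" for x y
    using that pref_asym by (auto simp: prec_def objs_def)
  have negtrans: "(x, y) \<in> prec \<or> (y, z) \<in> prec" if "(x, z) \<in> prec" "y \<in> objs" for x y z
    using that pref_negtrans[of "snd x" "snd y" "snd z"] consistent_lang
    by (auto simp: prec_def objs_def)
  have "prec \<subseteq> objs \<times> objs"
    by (auto simp: prec_def)
  moreover have "irrefl prec"
    using asym by (auto simp: irrefl_def)
  \<comment> \<open>For x below y below z, negative transitivity puts x below z or z below y, and
    asymmetry excludes the latter. Modularity follows in the same way.\<close>
  moreover have "trans prec"
    using asym negtrans \<open>prec \<subseteq> objs \<times> objs\<close> by (intro transI) blast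
  moreover have "inc \<subseteq> objs \<times> M"
    by (auto simp: inc_def)
  ultimately show ?thesis
    using negtrans unfolding ranked_context_def by blast
qed

lemma sat_compatible:
  assumes "normal v \<alpha>" "sat v \<phi>"
  shows "(\<alpha>, Neg \<phi>) \<notin> C"
  using assms by (auto simp: normal_def)

text \<open>No object satisfying \<phi> is ranked below \<phi>, and a satisfiable \<phi> has an
  object \<open>(w, \<phi>)\<close> at its own rank. Minimality thus depends only on comparing
  \<alpha> with \<phi>.\<close>

lemma minimals_extent_objs:
  assumes "\<phi> \<in> lang M"
  shows "minimals prec (extent objs inc \<phi>) =
    {(v, \<alpha>). consistent \<alpha> \<and> normal v \<alpha> \<and> sat v \<phi> \<and> \<not> pref \<phi> \<alpha>}"
    (is "?L = ?R")
proof (intro equalityI subsetI)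
  fix x assume x: "x \<in> ?L"
  obtain v \<alpha> where [simp]: "x = (v, \<alpha>)"
    by force
  have \<alpha>: "consistent \<alpha>" "normal v \<alpha>" "sat v \<phi>"
    using x assms by (auto simp: minimals_def in_extent_iff)
  have "consistent \<phi>"
    using consistent_if_compatible[OF \<alpha>(1) assms] sat_compatible \<alpha> by blast
  then obtain w where w: "normal w \<phi>"
    using normal_refuting[OF assms, of "Neg \<phi>"] assms by (auto simp: consistent_def)
  have "sat w \<phi>"
    using w REF[OF assms] by (auto simp: normal_def)
  then have "(w, \<phi>) \<in> extent objs inc \<phi>"
    using \<open>consistent \<phi>\<close> w assms by (simp add: in_extent_iff)
  then have "((w, \<phi>), x) \<notin> prec"
    using x by (auto simp: minimals_def)
  then show "x \<in> ?R"
    using \<open>consistent \<phi>\<close> w \<alpha> by (auto simp: prec_def objs_def)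
next
  fix x assume "x \<in> ?R"
  then obtain v \<alpha> where [simp]: "x = (v, \<alpha>)"
    and \<alpha>: "consistent \<alpha>" "normal v \<alpha>" "sat v \<phi>" "\<not> pref \<phi> \<alpha>"
    by auto
  have "(y, x) \<notin> prec" if y: "y \<in> extent objs inc \<phi>" for y
  proof -
    obtain w \<beta> where [simp]: "y = (w, \<beta>)"
      by force
    have \<beta>: "consistent \<beta>" "normal w \<beta>" "sat w \<phi>"
      using y assms by (auto simp: in_extent_iff)
    then have "\<not> pref \<beta> \<phi>"
      using not_pref_if_compatible assms sat_compatible by blast
    \<comment> \<open>If y were below x, negative transitivity through \<phi> would give
      \<open>pref \<beta> \<phi>\<close> or \<open>pref \<phi> \<alpha>\<close>, both
      excluded.\<close>
    then show ?thesis
      using pref_negtrans[OF \<beta>(1) assms] \<alpha>(4) by (auto simp: prec_def)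
  qed
  then show "x \<in> ?L"
    using \<alpha> assms by (auto simp: minimals_def in_extent_iff)
qed

text \<open>The same object \<open>(w, \<phi>)\<close> serves for every x: it is minimal, and it
  lies below x unless x is minimal itself.\<close>

lemma smooth_objs: "smooth objs M inc prec"
  unfolding smooth_def
proof (intro ballI)
  fix \<phi> x assume \<phi>: "\<phi> \<in> lang M" and x: "x \<in> extent objs inc \<phi>"
  obtain v \<alpha> where [simp]: "x = (v, \<alpha>)"
    by force
  have \<alpha>: "consistent \<alpha>" "normal v \<alpha>" "sat v \<phi>"
    using x \<phi> by (auto simp: in_extent_iff)
  have cons: "consistent \<phi>"
    using consistent_if_compatible[OF \<alpha>(1) \<phi>] sat_compatible \<alpha> by blast
  then obtain w where w: "normal w \<phi>"
    using normal_refuting[OF \<phi>, of "Neg \<phi>"] \<phi> by (auto simp: consistent_def)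
  have "sat w \<phi>" "\<not> pref \<phi> \<phi>"
    using w REF[OF \<phi>] pref_asym[OF cons] by (auto simp: normal_def)
  then have "(w, \<phi>) \<in> minimals prec (extent objs inc \<phi>)"
    using cons w \<phi> by (simp add: minimals_extent_objs)
  moreover have "((w, \<phi>), x) \<in> prec" if "pref \<phi> \<alpha>"
    using that cons w \<alpha> by (simp add: prec_def objs_def)
  moreover have "x \<in> minimals prec (extent objs inc \<phi>)" if "\<not> pref \<phi> \<alpha>"
    using that \<alpha> \<phi> by (simp add: minimals_extent_objs)
  ultimately show "x \<in> minimals prec (extent objs inc \<phi>) \<or>
      (\<exists>h\<in>minimals prec (extent objs inc \<phi>). (h, x) \<in> prec)"
    by blast
qed

lemma induced_objs: "induced objs M inc prec = C"
proof -
  have "minimals prec (extent objs inc \<phi>) \<subseteq> extent objs inc \<psi> \<longleftrightarrow> (\<phi>, \<psi>) \<in> C"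
    if l: "\<phi> \<in> lang M" "\<psi> \<in> lang M" for \<phi> \<psi>
  proof
    assume C: "(\<phi>, \<psi>) \<in> C"
    show "minimals prec (extent objs inc \<phi>) \<subseteq> extent objs inc \<psi>"
    proof
      fix x assume "x \<in> minimals prec (extent objs inc \<phi>)"
      then obtain v \<alpha> where [simp]: "x = (v, \<alpha>)"
        and \<alpha>: "consistent \<alpha>" "normal v \<alpha>" "sat v \<phi>" "\<not> pref \<phi> \<alpha>"
        using l by (auto simp: minimals_extent_objs)
      have "sat v (Or (Neg \<phi>) \<psi>)"
        using cond_transfer[OF \<alpha>(1) C \<alpha>(4)] \<alpha>(2) unfolding normal_def by blast
      then show "x \<in> extent objs inc \<psi>"
        using \<alpha> l by (simp add: in_extent_iff)
    qed
  next
    assume sub: "minimals prec (extent objs inc \<phi>) \<subseteq> extent objs inc \<psi>"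
    show "(\<phi>, \<psi>) \<in> C"
    proof (rule ccontr)
      assume no: "(\<phi>, \<psi>) \<notin> C"
      then have cons: "consistent \<phi>"
        using consistentI l by blast
      obtain v where v: "normal v \<phi>" "\<not> sat v \<psi>"
        using normal_refuting[OF l no] by blast
      moreover have "sat v \<phi>" "\<not> pref \<phi> \<phi>"
        using v REF[OF l(1)] pref_asym[OF cons] by (auto simp: normal_def)
      ultimately have "(v, \<phi>) \<in> minimals prec (extent objs inc \<phi>)"
        using cons l by (simp add: minimals_extent_objs)
      then show False
        using sub v(2) l by (auto simp: in_extent_iff)
    qed
  qed
  then show ?thesis
    using subset by (auto simp: induced_def)
qed

end

subsection \<open>Ranked contexts\<close>

text \<open>Each object acts as the valuation formed by its attributes, which is why classical
  entailment gives inclusion of extents in every context.\<close>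

lemma extent_iff_sat: "g \<in> extent G I \<phi> \<longleftrightarrow> g \<in> G \<and> sat {m. (g, m) \<in> I} \<phi>"
  by (induction \<phi>) auto

lemma entails_imp_ctx_implies: "entails \<phi> \<psi> \<Longrightarrow> ctx_implies G I \<phi> \<psi>"
  by (auto simp: entails_def ctx_implies_def extent_iff_sat)

lemma minimals_subset: "minimals P B \<subseteq> B"
  by (auto simp: minimals_def)

lemma minimals_Un_subset: "minimals P (A \<union> B) \<subseteq> minimals P A \<union> minimals P B"
  by (auto simp: minimals_def)

lemma minimals_subset_Int: "minimals P A \<subseteq> B \<Longrightarrow> minimals P A \<subseteq> minimals P (A \<inter> B)"
  by (auto simp: minimals_def)

text \<open>The second premise is smoothness at A. Minimal objects of A lie in B, so none of them
  can be below a minimal object of the intersection.\<close>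

lemma minimals_Int_cautious:
  assumes "minimals P A \<subseteq> B"
    and "\<And>g. g \<in> A \<Longrightarrow> g \<in> minimals P A \<or> (\<exists>h\<in>minimals P A. (h, g) \<in> P)"
  shows "minimals P (A \<inter> B) \<subseteq> minimals P A"
proof
  fix g assume g: "g \<in> minimals P (A \<inter> B)"
  have "(h, g) \<notin> P" if "h \<in> minimals P A" for h
    using g that assms(1) by (auto simp: minimals_def)
  then show "g \<in> minimals P A"
    using g assms(2)[of g] by (auto simp: minimals_def)
qed

lemma minimals_Int_rational:
  assumes "ranked_context G M I P" "A \<subseteq> G" "minimals P A \<inter> B \<noteq> {}"
  shows "minimals P (A \<inter> B) \<subseteq> minimals P A"
proof
  fix g assume g: "g \<in> minimals P (A \<inter> B)"
  obtain k where k: "k \<in> minimals P A" "k \<in> B"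
    using assms(3) by blast
  have incomparable: "(g, k) \<notin> P" "(k, g) \<notin> P"
    using g k by (auto simp: minimals_def)
  have "(h, g) \<notin> P" if "h \<in> A" for h
  proof
    assume "(h, g) \<in> P"
    moreover have "g \<in> G" "k \<in> G" "h \<in> G"
      using g k that assms(2) by (auto simp: minimals_def)
    \<comment> \<open>Modularity replaces g by the incomparable k, whose minimality in A is then
      violated.\<close>
    ultimately have "(h, k) \<in> P"
      using incomparable assms(1) unfolding ranked_context_def by blast
    then show False
      using k that by (auto simp: minimals_def)
  qed
  then show "g \<in> minimals P A"
    using g by (auto simp: minimals_def)
qed

text \<open>The parameter \<open>imp\<close> covers both readings of the underlying logic, since the
  postulates need no more of it than inclusion of extents.\<close>

lemma rational_induced:
  assumes ranked: "ranked_context G M I P" and smooth: "smooth G M I P"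
    and imp: "\<And>\<phi> \<psi>. imp \<phi> \<psi> \<Longrightarrow> ctx_implies G I \<phi> \<psi>"
  shows "rational M imp (induced G M I P)"
proof -
  let ?E = "extent G I"
  have G: "?E \<phi> \<subseteq> G" for \<phi>
    by (auto simp: extent_iff_sat)
  have CM: "minimals P (?E \<phi> \<inter> ?E \<psi>) \<subseteq> ?E \<gamma>"
    if "\<phi> \<in> lang M" "minimals P (?E \<phi>) \<subseteq> ?E \<psi>" "minimals P (?E \<phi>) \<subseteq> ?E \<gamma>" for \<phi> \<psi> \<gamma>
    using minimals_Int_cautious[OF that(2)] smooth that(1,3) unfolding smooth_def by blast
  have RM: "minimals P (?E \<phi> \<inter> ?E \<gamma>) \<subseteq> ?E \<psi>"
    if "minimals P (?E \<phi>) \<subseteq> ?E \<psi>" "\<not> minimals P (?E \<phi>) \<subseteq> G - ?E \<gamma>" for \<phi> \<psi> \<gamma>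
  proof -
    have "minimals P (?E \<phi>) \<inter> ?E \<gamma> \<noteq> {}"
      using that(2) G[of \<phi>] minimals_subset[of P "?E \<phi>"] by blast
    then show ?thesis
      using minimals_Int_rational[OF ranked G, of \<phi> "?E \<gamma>"] that(1) by blast
  qed
  have OR: "minimals P (?E \<phi> \<union> ?E \<psi>) \<subseteq> ?E \<gamma>"
    if "minimals P (?E \<phi>) \<subseteq> ?E \<gamma>" "minimals P (?E \<psi>) \<subseteq> ?E \<gamma>" for \<phi> \<psi> \<gamma>
    using minimals_Un_subset[of P "?E \<phi>" "?E \<psi>"] that by blast
  have CUT: "minimals P (?E \<phi>) \<subseteq> ?E \<gamma>"
    if "minimals P (?E \<phi> \<inter> ?E \<psi>) \<subseteq> ?E \<gamma>" "minimals P (?E \<phi>) \<subseteq> ?E \<psi>" for \<phi> \<psi> \<gamma>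
    using minimals_subset_Int[OF that(2)] that(1) by blast
  have imp: "?E \<phi> \<subseteq> ?E \<psi>" if "imp \<phi> \<psi>" for \<phi> \<psi>
    using imp[OF that] by (simp add: ctx_implies_def)
  have LLE: "minimals P (?E \<phi>) \<subseteq> ?E \<gamma>"
    if "imp \<phi> \<psi>" "imp \<psi> \<phi>" "minimals P (?E \<psi>) \<subseteq> ?E \<gamma>" for \<phi> \<psi> \<gamma>
    using imp[OF that(1)] imp[OF that(2)] that(3) by (metis subset_antisym)
  show ?thesis
    unfolding rational_def induced_def
    \<comment> \<open>Simplification closes AND. The remaining goals are REF, LLE, RW, OR, CUT, CM
      and RM, in this order.\<close>
    apply (intro conjI ballI impI; simp)
    subgoal by (rule minimals_subset)
    subgoal by (elim conjE) (erule (2) LLE)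
    subgoal by (elim conjE) (drule imp, rule subset_trans)
    subgoal by (elim conjE) (erule (1) OR)
    subgoal by (elim conjE) (erule (1) CUT)
    subgoal by (elim conjE) (rule CM)
    subgoal by (elim conjE) (erule (1) RM)
    done
qed

theorem theorem6:
  fixes M :: "'m set" and C :: "('m form \<times> 'm form) set"
  assumes "C \<subseteq> lang M \<times> lang M"
  shows "(rational M entails C \<longleftrightarrow>
            (\<exists>(G :: 'm obj set) I P.
               ranked_context G M I P \<and> smooth G M I P \<and> C = induced G M I P)) \<and>
         (\<forall>(G :: 'g set) I P.
            ranked_context G M I P \<and> smooth G M I P \<and> C = induced G M I P \<longrightarrow>
              rational M entails C \<and> rational M (ctx_implies G I) C)"
proof -
  have completeness: "\<exists>(G :: 'm obj set) I P.
      ranked_context G M I P \<and> smooth G M I P \<and> C = induced G M I P" if "rational M entails C"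
  proof -
    interpret rational_relation M C
      using that assms by unfold_locales
    show ?thesis
      using ranked_context_objs smooth_objs induced_objs by blast
  qed
  \<comment> \<open>The converse at type \<open>'m obj\<close> and the second conjunct at type
    \<open>'g\<close> are both soundness, with \<open>imp\<close> taken as \<open>entails\<close> or
    \<open>ctx_implies G I\<close>.\<close>
  show ?thesis
    by (intro conjI iffI allI impI completeness)
      (auto elim: rational_induced[OF _ _ entails_imp_ctx_implies] rational_induced)
qed

end
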